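(* Let $F_1,\dots,F_K:\mathbb{R}^d\to\mathbb{R}$ be $L$-smooth (not necessarily convex), let $f=\frac1K\sum_{k=1}^KF_k$, and assume that $f$ has a global minimizer $\hat w$. Let $$\theta:=\left[\frac{(1-\gamma)^2}{\eta(L+\mu)}-\frac{2L}{(\mu-L)^2}-\frac{2\gamma(L+\mu)}{\eta(\mu-L)^2}\right]\eta^2,$$ where $\eta>0$, $0\le\gamma<1$ and $\mu>L$ are such that $\theta>0$. Let $\{w^t\}$ be the iterates of the nonconvex version of INEXACTDANE with Option II applied to $f=\frac1K\sum_kF_k$ with parameters $\mu,\eta,\gamma$, from any initial point $w^0\in\mathbb{R}^d$. Then for every $t\ge1$, $$\min_{0\le t'\le t-1}\|\nabla f(w^{t'})\|^2\le\frac{f(w^0)-f(\hat w)}{\theta\,t}.$$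
   Context: A function $\psi:\mathbb{R}^d\to\mathbb{R}$ is $L$-smooth if it is differentiable and $\|\nabla\psi(x)-\nabla\psi(y)\|\le L\|x-y\|$ for all $x,y$. $\|\cdot\|$ is the Euclidean norm. Nonconvex version of INEXACTDANE (Option II) for $f=\frac1K\sum_{k=1}^K F_k$ with parameters $\mu,\eta,\gamma$: starting from $w^0$, for $t=1,2,\dots$ and each $k\in\{1,\dots,K\}$ set $$g^t_{k,\mu}(w)=F_k(w)-\langle\nabla F_k(w^{t-1})-\eta\nabla f(w^{t-1}),w\rangle+\tfrac{\mu}{2}\|w-w^{t-1}\|^2,\qquad \hat w_k^t=\arg\min_w g^t_{k,\mu}(w),$$ let $w_k^t$ be any point satisfying both $\|\nabla g^t_{k,\mu}(w_k^t)\|\le\gamma\|\nabla g^t_{k,\mu}(w^{t-1})\|$ and $\|w_k^t-\hat w_k^t\|\le\gamma\|w^{t-1}-\hat w_k^t\|$, and let $w^t$ be an arbitrarily selected element of $\{w_1^t,\dots,w_K^t\}$ (instead of their average). *)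

theory Defs
  imports "HOL-Analysis.Analysis"
begin

(* Meaningful at points of differentiability; there the Riesz representation makes
   the gradient exist and be unique. *)
definition gradient :: "('a::euclidean_space \<Rightarrow> real) \<Rightarrow> 'a \<Rightarrow> 'a" where
  "gradient f x = (THE D. GDERIV f x :> D)"

definition smooth_with :: "real \<Rightarrow> ('a::euclidean_space \<Rightarrow> real) \<Rightarrow> bool" where
  "smooth_with L f \<longleftrightarrow>
     (\<forall>x. f differentiable (at x)) \<and>
     (\<forall>x y. norm (gradient f x - gradient f y) \<le> L * norm (x - y))"

definition average :: "nat \<Rightarrow> (nat \<Rightarrow> 'a \<Rightarrow> real) \<Rightarrow> 'a \<Rightarrow> real" where
  "average K F w = (1 / real K) * (\<Sum>k=1..K. F k w)"

(* The local objective g^t_{k,mu}, with v standing for the previous iterate w^{t-1}. *)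
definition dane_objective ::
  "nat \<Rightarrow> (nat \<Rightarrow> 'a::euclidean_space \<Rightarrow> real) \<Rightarrow> real \<Rightarrow> real \<Rightarrow> 'a \<Rightarrow> nat \<Rightarrow> 'a \<Rightarrow> real" where
  "dane_objective K F \<mu> \<eta> v k w =
     F k w - (gradient (F k) v - \<eta> *\<^sub>R gradient (average K F) v) \<bullet> w
       + \<mu> / 2 * (norm (w - v))\<^sup>2"

(* A run of the nonconvex version of InexactDANE (Option II): w t is the global iterate,
   wloc t k and wopt t k are the inexact and the exact local solutions w_k^t and hat w_k^t.
   The choices of the method (inexact local solutions, selected worker) are left open. *)
definition inexact_dane_run ::
  "nat \<Rightarrow> (nat \<Rightarrow> 'a::euclidean_space \<Rightarrow> real) \<Rightarrow> real \<Rightarrow> real \<Rightarrow> real \<Rightarrow>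
   (nat \<Rightarrow> 'a) \<Rightarrow> (nat \<Rightarrow> nat \<Rightarrow> 'a) \<Rightarrow> (nat \<Rightarrow> nat \<Rightarrow> 'a) \<Rightarrow> bool" where
  "inexact_dane_run K F \<mu> \<eta> \<gamma> w wloc wopt \<longleftrightarrow>
     (\<forall>t\<ge>1.
        (\<forall>k\<in>{1..K}.
           is_arg_min (dane_objective K F \<mu> \<eta> (w (t - 1)) k) (\<lambda>_. True) (wopt t k) \<and>
           norm (gradient (dane_objective K F \<mu> \<eta> (w (t - 1)) k) (wloc t k))
             \<le> \<gamma> * norm (gradient (dane_objective K F \<mu> \<eta> (w (t - 1)) k) (w (t - 1))) \<and>
           norm (wloc t k - wopt t k) \<le> \<gamma> * norm (w (t - 1) - wopt t k)) \<and>
        w t \<in> wloc t ` {1..K})"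

end

theory Submission
  imports Defs
begin

text \<open>
  Write \<open>v\<close> for the previous iterate, \<open>x\<close> for the selected inexact local solution and
  \<open>G\<close> for the gradient of \<open>f\<close> at \<open>v\<close>. The local objective has gradient \<open>\<eta> G\<close> at \<open>v\<close> and
  gradient \<open>e\<close> with \<open>norm e \<le> \<gamma> \<eta> norm G\<close> at \<open>x\<close>. Adding \<open>\<mu> d\<close> to a gradient difference that is
  bounded by \<open>L norm d\<close> with \<open>L \<le> \<mu>\<close> gives an operator that is strongly monotone and co-coercive;
  both facts are plain inner product algebra, without any appeal to convexity. Co-coercivity
  makes \<open>x - v\<close> a descent direction and strong monotonicity bounds its length, so the descent
  lemma for \<open>f\<close> yields \<open>f x \<le> f v - \<theta> (norm G)\<^sup>2\<close>, which telescopes.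
\<close>

section \<open>Uniqueness and existence of the gradient\<close>

lemma GDERIV_unique:
  assumes "GDERIV f x :> D" "GDERIV f x :> E"
  shows "D = E"
proof -
  have "(\<lambda>h. h \<bullet> D) = (\<lambda>h. h \<bullet> E)"
    using assms unfolding gderiv_def by (rule has_derivative_unique)
  then have "(D - E) \<bullet> D = (D - E) \<bullet> E"
    by meson
  then have "(D - E) \<bullet> (D - E) = 0"
    by (simp add: inner_diff_right)
  then show ?thesis
    by simp
qed

lemma gradient_eqI:
  assumes "GDERIV f x :> D"
  shows "gradient f x = D"
  unfolding gradient_def using assms GDERIV_unique by blast

lemma GDERIV_gradient:
  fixes f :: "'a::euclidean_space \<Rightarrow> real"
  assumes "f differentiable (at x)"
  shows "GDERIV f x :> gradient f x"
proof -
  obtain f' where f': "(f has_derivative f') (at x)"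
    using assms by (auto simp: differentiable_def)
  then have lin: "linear f'"
    by (rule has_derivative_linear)
  \<comment> \<open>Riesz representation made explicit: the gradient has the coordinates
    \<open>f' b\<close> in the basis.\<close>
  have "f' = (\<lambda>h. h \<bullet> (\<Sum>b\<in>Basis. f' b *\<^sub>R b))"
  proof
    fix h
    have "f' h = f' (\<Sum>b\<in>Basis. (h \<bullet> b) *\<^sub>R b)"
      by (simp add: euclidean_representation)
    also have "\<dots> = (\<Sum>b\<in>Basis. (h \<bullet> b) * f' b)"
      by (simp add: linear_sum[OF lin] linear_scale[OF lin])
    also have "\<dots> = h \<bullet> (\<Sum>b\<in>Basis. f' b *\<^sub>R b)"
      by (simp add: inner_sum_right mult.commute)
    finally show "f' h = h \<bullet> (\<Sum>b\<in>Basis. f' b *\<^sub>R b)" .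
  qed
  with f' have "GDERIV f x :> (\<Sum>b\<in>Basis. f' b *\<^sub>R b)"
    by (simp add: gderiv_def)
  then show ?thesis
    by (simp add: gradient_eqI)
qed

section \<open>Smoothness and the descent lemma\<close>

lemma smooth_with_GDERIV:
  "smooth_with L f \<Longrightarrow> GDERIV f x :> gradient f x"
  by (simp add: GDERIV_gradient smooth_with_def)

text \<open>A basis vector and the origin are at distance 1, so a negative \<open>L\<close> would
  bound a norm by a negative number.\<close>

lemma smooth_with_nonneg:
  fixes f :: "'a::euclidean_space \<Rightarrow> real"
  assumes "smooth_with L f"
  shows "0 \<le> L"
proof -
  obtain b :: 'a where "b \<in> Basis"
    using nonempty_Basis by blast
  have "0 \<le> norm (gradient f b - gradient f 0)"
    by simp
  also have "\<dots> \<le> L * norm (b - 0)"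
    using assms unfolding smooth_with_def by blast
  finally show ?thesis
    using \<open>b \<in> Basis\<close> by simp
qed

lemma smooth_with_descent:
  assumes "smooth_with L f"
  shows "f x \<le> f v + gradient f v \<bullet> (x - v) + L / 2 * (norm (x - v))\<^sup>2"
proof -
  have lipschitz: "norm (gradient f y - gradient f z) \<le> L * norm (y - z)" for y z
    using assms by (simp add: smooth_with_def)
  define d where "d = x - v"
  \<comment> \<open>The gap between \<open>f\<close> and its quadratic upper model along the segment
    from \<open>v\<close> to \<open>x\<close>. It suffices that \<open>\<phi>\<close> decreases on
    [0, 1], so no integral of the gradient is needed.\<close>
  define \<phi> where
    "\<phi> s = f (v + s *\<^sub>R d) - s * (gradient f v \<bullet> d) - L / 2 * s\<^sup>2 * (norm d)\<^sup>2" for s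
  define \<phi>' where
    "\<phi>' s = gradient f (v + s *\<^sub>R d) \<bullet> d - gradient f v \<bullet> d - L * s * (norm d)\<^sup>2" for s
  have der: "(\<phi> has_real_derivative \<phi>' s) (at s)" for s
  proof -
    have "(f has_derivative (\<lambda>h. h \<bullet> gradient f (v + s *\<^sub>R d))) (at (v + s *\<^sub>R d))"
      using smooth_with_GDERIV[OF assms] by (simp add: gderiv_def)
    moreover have "((\<lambda>s. v + s *\<^sub>R d) has_derivative (\<lambda>h. h *\<^sub>R d)) (at s)"
      by (auto intro!: derivative_eq_intros)
    ultimately have
      "((\<lambda>s. f (v + s *\<^sub>R d)) has_derivative (\<lambda>h. (h *\<^sub>R d) \<bullet> gradient f (v + s *\<^sub>R d))) (at s)"
      by (rule has_derivative_compose[rotated])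
    then have "((\<lambda>s. f (v + s *\<^sub>R d)) has_real_derivative gradient f (v + s *\<^sub>R d) \<bullet> d) (at s)"
      by (rule has_derivative_imp_has_field_derivative) (simp add: inner_commute)
    then show ?thesis
      unfolding \<phi>_def \<phi>'_def by (auto intro!: derivative_eq_intros)
  qed
  \<comment> \<open>The sign of \<open>s\<close> matters: it turns the norm of
    \<open>s *\<^sub>R d\<close> into \<open>s * norm d\<close>.\<close>
  have "\<phi>' s \<le> 0" if "0 \<le> s" for s
  proof -
    have "(gradient f (v + s *\<^sub>R d) - gradient f v) \<bullet> d
        \<le> norm (gradient f (v + s *\<^sub>R d) - gradient f v) * norm d"
      by (rule norm_cauchy_schwarz)
    also have "\<dots> \<le> L * norm ((v + s *\<^sub>R d) - v) * norm d"
      by (intro mult_right_mono lipschitz norm_ge_zero)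
    also have "\<dots> = L * s * (norm d)\<^sup>2"
      using that by (simp add: power2_eq_square)
    finally show ?thesis
      by (simp add: \<phi>'_def inner_diff_left)
  qed
  then have "\<phi> 1 \<le> \<phi> 0"
    using der by (intro DERIV_nonpos_imp_nonincreasing[of 0 1]) (simp, blast)
  then show ?thesis
    by (simp add: \<phi>_def d_def)
qed

section \<open>Gradients of the average and of the local objective\<close>

lemma GDERIV_average:
  fixes F :: "nat \<Rightarrow> 'a::euclidean_space \<Rightarrow> real"
  assumes "\<And>k. k \<in> {1..K} \<Longrightarrow> GDERIV (F k) x :> G k"
  shows "GDERIV (average K F) x :> (1 / real K) *\<^sub>R (\<Sum>k=1..K. G k)"
proof -
  have "((\<lambda>w. \<Sum>k=1..K. F k w) has_derivative (\<lambda>h. \<Sum>k=1..K. h \<bullet> G k)) (at x)"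
    using assms by (intro has_derivative_sum) (simp add: gderiv_def)
  then have "((\<lambda>w. (1 / real K) * (\<Sum>k=1..K. F k w)) has_derivative
      (\<lambda>h. (1 / real K) * (\<Sum>k=1..K. h \<bullet> G k))) (at x)"
    by (rule has_derivative_mult_right)
  then show ?thesis
    by (simp add: gderiv_def average_def[abs_def] inner_sum_right)
qed

lemma smooth_with_average:
  fixes F :: "nat \<Rightarrow> 'a::euclidean_space \<Rightarrow> real"
  assumes "K \<ge> 1" and F: "\<And>k. k \<in> {1..K} \<Longrightarrow> smooth_with L (F k)"
  shows "smooth_with L (average K F)"
proof -
  have G: "GDERIV (average K F) x :> (1 / real K) *\<^sub>R (\<Sum>k=1..K. gradient (F k) x)" for x
    using F by (intro GDERIV_average smooth_with_GDERIV)
  have "norm (gradient (average K F) x - gradient (average K F) y) \<le> L * norm (x - y)" for x y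
  proof -
    have "norm (gradient (average K F) x - gradient (average K F) y)
        = norm (\<Sum>k=1..K. gradient (F k) x - gradient (F k) y) / real K"
      by (simp add: gradient_eqI[OF G] sum_subtractf flip: scaleR_diff_right)
    also have "\<dots> \<le> (\<Sum>k=1..K. L * norm (x - y)) / real K"
      using F by (intro divide_right_mono sum_norm_le) (auto simp: smooth_with_def)
    also have "\<dots> = L * norm (x - y)"
      using \<open>K \<ge> 1\<close> by simp
    finally show ?thesis .
  qed
  moreover have "average K F differentiable (at x)" for x
    using G[of x] by (auto simp: gderiv_def differentiable_def)
  ultimately show ?thesis
    by (simp add: smooth_with_def)
qed

text \<open>At \<open>x = v\<close> everything cancels except \<open>\<eta>\<close> times the
  gradient of the average; this turns the inexactness criterion into a bound by the global
  gradient.\<close>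

lemma gradient_dane_objective:
  fixes F :: "nat \<Rightarrow> 'a::euclidean_space \<Rightarrow> real"
  assumes "smooth_with L (F k)"
  shows "gradient (dane_objective K F \<mu> \<eta> v k) x
    = gradient (F k) x - gradient (F k) v + \<eta> *\<^sub>R gradient (average K F) v + \<mu> *\<^sub>R (x - v)"
proof (rule gradient_eqI)
  have "(F k has_derivative (\<lambda>h. h \<bullet> gradient (F k) x)) (at x)"
    using smooth_with_GDERIV[OF assms] by (simp add: gderiv_def)
  then show "GDERIV (dane_objective K F \<mu> \<eta> v k) x :>
      gradient (F k) x - gradient (F k) v + \<eta> *\<^sub>R gradient (average K F) v + \<mu> *\<^sub>R (x - v)"
    unfolding gderiv_def dane_objective_def[abs_def] power2_norm_eq_inner
    by (auto intro!: derivative_eq_intros simp: algebra_simps inner_simps inner_commute)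
qed

section \<open>Estimates for shifted gradient differences\<close>

lemma shifted_strongly_monotone:
  fixes d D :: "'a::real_inner"
  assumes "norm D \<le> L * norm d"
  shows "(\<mu> - L) * norm d \<le> norm (D + \<mu> *\<^sub>R d)"
proof -
  \<comment> \<open>Stated as an inequality, this holds for either sign of \<open>\<mu>\<close>; the
    rest is the triangle inequality.\<close>
  have "\<mu> * norm d \<le> norm (\<mu> *\<^sub>R d)"
    by (simp add: mult_right_mono)
  also have "\<dots> \<le> norm (D + \<mu> *\<^sub>R d) + norm D"
    using norm_triangle_ineq4[of "D + \<mu> *\<^sub>R d" D] by simp
  finally show ?thesis
    using assms by (simp add: algebra_simps)
qed

text \<open>Right side minus left side equals \<open>(\<mu> - L) * (L * (d \<bullet> d) - D
  \<bullet> d) + (L\<^sup>2 * (d \<bullet> d) - D \<bullet> D)\<close>, and both summands are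
  nonnegative.\<close>

lemma shifted_cocoercive:
  fixes d D :: "'a::real_inner"
  assumes D: "norm D \<le> L * norm d" and "0 \<le> L" "L \<le> \<mu>"
  shows "(norm (D + \<mu> *\<^sub>R d))\<^sup>2 \<le> (L + \<mu>) * ((D + \<mu> *\<^sub>R d) \<bullet> d)"
proof -
  have "D \<bullet> d \<le> norm D * norm d"
    by (rule norm_cauchy_schwarz)
  also have "\<dots> \<le> L * (d \<bullet> d)"
    using mult_right_mono[OF D, of "norm d"] by (simp add: dot_square_norm power2_eq_square)
  finally have "0 \<le> (\<mu> - L) * (L * (d \<bullet> d) - D \<bullet> d)"
    using \<open>L \<le> \<mu>\<close> by simp
  moreover have "D \<bullet> D \<le> L\<^sup>2 * (d \<bullet> d)"
    using power_mono[OF D, of 2] by (simp add: dot_square_norm power_mult_distrib)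
  ultimately show ?thesis
    unfolding power2_norm_eq_inner
    by (simp add: inner_simps inner_commute algebra_simps power2_eq_square)
qed

section \<open>Sufficient decrease in one round\<close>

lemma inexact_dane_step:
  fixes F :: "nat \<Rightarrow> 'a::euclidean_space \<Rightarrow> real" and v x :: 'a
  assumes Fk: "smooth_with L (F k)" and f: "smooth_with L f" "f = average K F"
    and \<theta>: "\<theta> = ((1 - \<gamma>)\<^sup>2 / (\<eta> * (L + \<mu>)) - 2 * L / (\<mu> - L)\<^sup>2
              - 2 * \<gamma> * (L + \<mu>) / (\<eta> * (\<mu> - L)\<^sup>2)) * \<eta>\<^sup>2"
    and par: "\<eta> > 0" "0 \<le> \<gamma>" "\<gamma> < 1" "\<mu> > L"
    and inexact: "norm (gradient (dane_objective K F \<mu> \<eta> v k) x)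
             \<le> \<gamma> * norm (gradient (dane_objective K F \<mu> \<eta> v k) v)"
  shows "f x \<le> f v - \<theta> * (norm (gradient f v))\<^sup>2"
proof -
  define d where "d = x - v"
  define D where "D = gradient (F k) x - gradient (F k) v"
  define G where "G = gradient f v"
  \<comment> \<open>The gradient of the local objective at \<open>x\<close>, that is, the residual
    of the inexact solve.\<close>
  define e where "e = D + \<mu> *\<^sub>R d + \<eta> *\<^sub>R G"
  define n where "n = norm G"
  \<comment> \<open>The three terms of \<open>\<theta>\<close> with \<open>\<eta>\<close> and
    \<open>\<gamma>\<close> split off: \<open>a\<close> comes from co-coercivity, \<open>b\<close>
    from the residual, and \<open>c\<close> from the quadratic term of the descent lemma.\<close>
  define a where "a = (1 - \<gamma>)\<^sup>2 / (L + \<mu>)"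
  define b where "b = (L + \<mu>) / (\<mu> - L)\<^sup>2"
  define c where "c = 2 * L / (\<mu> - L)\<^sup>2"
  have n: "n \<ge> 0" by (simp add: n_def)
  have L: "0 \<le> L"
    using Fk by (rule smooth_with_nonneg)
  have D: "norm D \<le> L * norm d"
    using Fk unfolding D_def d_def smooth_with_def by blast
  have e: "norm e \<le> \<gamma> * \<eta> * n"
    using inexact \<open>\<eta> > 0\<close> gradient_dane_objective[of L F k K \<mu> \<eta> v, OF Fk]
    by (simp add: e_def D_def d_def G_def n_def f(2) algebra_simps)
  have e': "D + \<mu> *\<^sub>R d = e - \<eta> *\<^sub>R G"
    by (simp add: e_def)
  have "(\<mu> - L) * norm d \<le> norm (e - \<eta> *\<^sub>R G)"
    using shifted_strongly_monotone[OF D, of \<mu>] by (simp add: e')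
  also have "\<dots> \<le> norm e + \<eta> * n"
    using norm_triangle_ineq4[of e "\<eta> *\<^sub>R G"] \<open>\<eta> > 0\<close> by (simp add: n_def)
  \<comment> \<open>Rounding \<open>1 + \<gamma>\<close> up to 2 produces the factors 2 in
    \<open>\<theta>\<close>: once in the residual term, and squared, times \<open>L / 2\<close>, in
    the term with \<open>L\<close>.\<close>
  also have "\<dots> \<le> 2 * \<eta> * n"
  proof -
    have "\<gamma> * (\<eta> * n) \<le> 1 * (\<eta> * n)"
      using par n by (intro mult_right_mono) auto
    then show ?thesis using e by simp
  qed
  finally have d_le: "norm d \<le> 2 * \<eta> * n / (\<mu> - L)"
    using par by (simp add: pos_le_divide_eq mult.commute)
  \<comment> \<open>The reverse triangle inequality keeps the shifted difference away from zero;
    squared, this is the source of the numerator of \<open>a\<close>.\<close>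
  have "(1 - \<gamma>) * \<eta> * n \<le> norm (e - \<eta> *\<^sub>R G)"
    using norm_triangle_ineq3[of e "\<eta> *\<^sub>R G"] e \<open>\<eta> > 0\<close>
    by (simp add: n_def algebra_simps)
  then have "((1 - \<gamma>) * \<eta> * n)\<^sup>2 \<le> (norm (e - \<eta> *\<^sub>R G))\<^sup>2"
    using par n by (intro power_mono) auto
  also have "\<dots> \<le> (L + \<mu>) * ((e - \<eta> *\<^sub>R G) \<bullet> d)"
    using shifted_cocoercive[OF D L, of \<mu>] par by (simp add: e')
  finally have "a * (\<eta>\<^sup>2 * n\<^sup>2) \<le> e \<bullet> d - \<eta> * (G \<bullet> d)"
    using par L
    by (simp add: a_def pos_divide_le_eq inner_diff_left power_mult_distrib mult_ac)
  moreover have "e \<bullet> d \<le> 2 * \<gamma> * b * (\<eta>\<^sup>2 * n\<^sup>2)"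
  proof -
    have "e \<bullet> d \<le> norm e * norm d"
      by (rule norm_cauchy_schwarz)
    also have "\<dots> \<le> (\<gamma> * \<eta> * n) * (2 * \<eta> * n / (\<mu> - L))"
      using e d_le par n by (intro mult_mono) auto
    also have "\<dots> = (2 * \<gamma> * (\<eta>\<^sup>2 * n\<^sup>2)) * ((\<mu> - L) / (\<mu> - L)\<^sup>2)"
      using par by (simp add: power2_eq_square)
    \<comment> \<open>The numerator \<open>\<mu> - L\<close> is weakened to
      \<open>L + \<mu>\<close>, as \<open>L\<close> is nonnegative, to reach the form in
      \<open>\<theta>\<close>.\<close>
    also have "\<dots> \<le> (2 * \<gamma> * (\<eta>\<^sup>2 * n\<^sup>2)) * b"
      unfolding b_def using par L by (intro mult_left_mono divide_right_mono) auto
    finally show ?thesis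
      by (simp add: mult_ac)
  qed
  ultimately have "\<eta> * (G \<bullet> d) \<le> \<eta> * ((2 * \<gamma> * b - a) * \<eta> * n\<^sup>2)"
    by (simp add: algebra_simps power2_eq_square)
  then have Gd: "G \<bullet> d \<le> (2 * \<gamma> * b - a) * \<eta> * n\<^sup>2"
    using \<open>\<eta> > 0\<close> by simp
  have "L / 2 * (norm d)\<^sup>2 \<le> L / 2 * (2 * \<eta> * n / (\<mu> - L))\<^sup>2"
    using d_le L by (intro mult_left_mono power_mono) auto
  also have "\<dots> = c * \<eta>\<^sup>2 * n\<^sup>2"
    by (simp add: c_def power_divide power_mult_distrib)
  finally have "f v + G \<bullet> d + L / 2 * (norm d)\<^sup>2 \<le> f v - ((a - 2 * \<gamma> * b) * \<eta> - c * \<eta>\<^sup>2) * n\<^sup>2"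
    using Gd by (simp add: algebra_simps)
  moreover have "f x \<le> f v + G \<bullet> d + L / 2 * (norm d)\<^sup>2"
    using smooth_with_descent[OF f(1)] by (simp add: G_def d_def)
  moreover have "\<theta> = (a - 2 * \<gamma> * b) * \<eta> - c * \<eta>\<^sup>2"
  proof -
    have "\<theta> = (a / \<eta> - c - 2 * \<gamma> * b / \<eta>) * \<eta>\<^sup>2"
      by (simp add: \<theta> a_def b_def c_def mult.commute)
    also have "\<dots> = (a - 2 * \<gamma> * b) * \<eta> - c * \<eta>\<^sup>2"
      using \<open>\<eta> > 0\<close> by (simp add: left_diff_distrib power2_eq_square)
    finally show ?thesis .
  qed
  ultimately show ?thesis
    by (simp add: n_def G_def)
qed

section \<open>Telescoping and the rate\<close>

lemma Min_le_of_sufficient_decrease: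
  fixes \<phi> a :: "nat \<Rightarrow> real"
  assumes step: "\<And>s. \<phi> (Suc s) \<le> \<phi> s - \<theta> * a s"
    and low: "\<And>s. m \<le> \<phi> s" and "\<theta> > 0" "t \<ge> 1"
  shows "(MIN s\<in>{0..t - 1}. a s) \<le> (\<phi> 0 - m) / (\<theta> * real t)"
proof -
  define M where "M = (MIN s\<in>{0..t - 1}. a s)"
  have M: "M \<le> a s" if "s < t" for s
    unfolding M_def using that by (intro Min_le) auto
  \<comment> \<open>The claim stops at \<open>s = t\<close>: reaching \<open>s\<close> uses only
    \<open>a 0\<close>, ..., \<open>a (s - 1)\<close>, and \<open>M\<close> bounds exactly the
    values below index \<open>t\<close>.\<close>
  have "\<phi> s \<le> \<phi> 0 - \<theta> * M * real s" if "s \<le> t" for s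
    using that
  proof (induction s)
    case (Suc s)
    have "\<theta> * M \<le> \<theta> * a s"
      using M[of s] Suc.prems \<open>\<theta> > 0\<close> by simp
    then show ?case
      using Suc step[of s] by (simp add: algebra_simps)
  qed simp
  from this[of t] low[of t] have "M * (\<theta> * real t) \<le> \<phi> 0 - m"
    by (simp add: algebra_simps)
  then show ?thesis
    using \<open>\<theta> > 0\<close> \<open>t \<ge> 1\<close> unfolding M_def[symmetric] by (simp add: pos_le_divide_eq)
qed

theorem theorem4:
  fixes F :: "nat \<Rightarrow> real ^ 'd \<Rightarrow> real"
    and K :: nat
    and L \<mu> \<eta> \<gamma> \<theta> :: real
    and f :: "real ^ 'd \<Rightarrow> real"
    and what :: "real ^ 'd"
    and w :: "nat \<Rightarrow> real ^ 'd"
    and wloc wopt :: "nat \<Rightarrow> nat \<Rightarrow> real ^ 'd"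
    and t :: nat
  assumes "K \<ge> 1"
    and "\<And>k. k \<in> {1..K} \<Longrightarrow> smooth_with L (F k)"
    and "f = average K F"
    and "is_arg_min f (\<lambda>_. True) what"
    and "\<theta> = ((1 - \<gamma>)\<^sup>2 / (\<eta> * (L + \<mu>)) - 2 * L / (\<mu> - L)\<^sup>2
              - 2 * \<gamma> * (L + \<mu>) / (\<eta> * (\<mu> - L)\<^sup>2)) * \<eta>\<^sup>2"
    and "\<eta> > 0" and "0 \<le> \<gamma>" and "\<gamma> < 1" and "\<mu> > L" and "\<theta> > 0"
    and "inexact_dane_run K F \<mu> \<eta> \<gamma> w wloc wopt"
    and "t \<ge> 1"
  shows "(MIN t'\<in>{0..t - 1}. (norm (gradient f (w t')))\<^sup>2) \<le> (f (w 0) - f what) / (\<theta> * real t)"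
proof (rule Min_le_of_sufficient_decrease)
  have f: "smooth_with L f"
    using smooth_with_average assms(1-3) by blast
  show "f (w (Suc s)) \<le> f (w s) - \<theta> * (norm (gradient f (w s)))\<^sup>2" for s
  proof -
    \<comment> \<open>Rounds are counted from 1 and round \<open>t\<close> starts at
      \<open>w (t - 1)\<close>, so passing from \<open>w s\<close> to its successor is round
      \<open>Suc s\<close>, with \<open>k\<close> the selected worker.\<close>
    obtain k where k: "k \<in> {1..K}" "w (Suc s) = wloc (Suc s) k"
      using assms(11) unfolding inexact_dane_run_def
      by (metis imageE le_add1 plus_1_eq_Suc)
    then have "norm (gradient (dane_objective K F \<mu> \<eta> (w s) k) (w (Suc s)))
        \<le> \<gamma> * norm (gradient (dane_objective K F \<mu> \<eta> (w s) k) (w s))"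
      using assms(11)[unfolded inexact_dane_run_def, rule_format, of "Suc s"] by simp
    then show ?thesis
      using inexact_dane_step[OF assms(2)[OF k(1)] f assms(3,5-9)] by blast
  qed
  show "f what \<le> f (w s)" for s
    using assms(4) by (simp add: is_arg_min_linorder)
qed fact+

end
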